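(* Consider the Game of Cards with $p$ players and $n=kp$ cards (so $n$ is a multiple of $p$). Then for every initial configuration $O$ there exists a player $i\in\{1,\dots,p\}$ such that in every sequence of moves starting from $O$, no move is made at position $i$ (player $i$ never gives a card to its neighbor).
   Context: Game of Cards: $p$ players sit in a cycle; indices are taken modulo $p$ (player $p$'s right neighbor is player $1$). A configuration is a vector $(a_1,\dots,a_p)$ of nonnegative integers with sum $n$. A move at position $i$ is allowed in $a$ iff $a_i>a_{i+1}$ (with $a_{p+1}=a_1$); it replaces $a_i$ by $a_i-1$ and $a_{i+1}$ by $a_{i+1}+1$, i.e. player $i$ gives a card to player $i+1$. *)

theory Defs
  imports Main
begin

text \<open>
  A configuration is the list of the players' card counts. Positions are counted from 0, so
  \<open>a ! i\<close> is the number of cards of player \<open>i + 1\<close>.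
\<close>

definition configuration :: "nat \<Rightarrow> nat \<Rightarrow> nat list \<Rightarrow> bool" where
  "configuration p n a \<longleftrightarrow> length a = p \<and> sum_list a = n"

definition neighbor :: "nat \<Rightarrow> nat \<Rightarrow> nat" where
  "neighbor p i = Suc i mod p"

definition move_allowed :: "nat list \<Rightarrow> nat \<Rightarrow> bool" where
  "move_allowed a i \<longleftrightarrow> i < length a \<and> a ! i > a ! neighbor (length a) i"

text \<open>
  Only used when \<open>move_allowed a i\<close> holds; then \<open>a ! i > 0\<close> and \<open>i\<close> differs from its neighbor, so
  neither the truncated subtraction nor the order of the two updates matters.
\<close>

definition make_move :: "nat list \<Rightarrow> nat \<Rightarrow> nat list" where
  "make_move a i =
     (let j = neighbor (length a) i in a[i := a ! i - 1, j := a ! j + 1])"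

text \<open>
  A sequence of moves is given by the list of its positions. Finite sequences suffice to say that a
  position is never used: each move of an infinite sequence lies in a finite initial segment.
\<close>

fun move_sequence :: "nat list \<Rightarrow> nat list \<Rightarrow> bool" where
  "move_sequence a [] \<longleftrightarrow> True"
| "move_sequence a (i # ms) \<longleftrightarrow> move_allowed a i \<and> move_sequence (make_move a i) ms"

end

theory Submission
  imports Defs
begin

text \<open>
  Since the average is \<open>k\<close>, there is a height function \<open>h\<close> on the cycle that changes by \<open>a\<^sub>i - k\<close>
  from \<open>i\<close> to its right neighbor. At a minimum \<open>j\<close> of \<open>h\<close> the left neighbor of \<open>j\<close> has at most
  \<open>k\<close> cards and \<open>j\<close> at least \<open>k\<close>, so no card can be given to \<open>j\<close>. A move at \<open>i\<close> lowers \<open>h\<close> by one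
  at the neighbor of \<open>i\<close> and nowhere else; as that neighbor was not a minimum, a minimum \<open>m\<close> of \<open>h\<close>
  stays a minimum. Hence nobody ever gives a card to \<open>m\<close>.
\<close>

definition height :: "nat \<Rightarrow> nat list \<Rightarrow> (nat \<Rightarrow> int) \<Rightarrow> bool" where
  "height k a h \<longleftrightarrow>
     (\<forall>i<length a. h (neighbor (length a) i) = h i + int (a ! i) - int k)"

lemma neighbor_less: "i < p \<Longrightarrow> neighbor p i < p"
  by (simp add: neighbor_def)

lemma neighbor_eq: "i < p \<Longrightarrow> neighbor p i = (if Suc i = p then 0 else Suc i)"
  by (simp add: neighbor_def)

lemma neighbor_inject: "i < p \<Longrightarrow> j < p \<Longrightarrow> neighbor p i = neighbor p j \<longleftrightarrow> i = j"
  by (auto simp: neighbor_eq split: if_splits)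

lemma neighbor_surj:
  assumes "j < p"
  obtains i where "i < p" "neighbor p i = j"
proof
  show "(if j = 0 then p - 1 else j - 1) < p"
    using assms by auto
  show "neighbor p (if j = 0 then p - 1 else j - 1) = j"
    using assms by (auto simp: neighbor_def)
qed

lemma move_allowed_neighbor:
  assumes "move_allowed a i"
  shows "i < length a" "neighbor (length a) i \<noteq> i"
    "a ! neighbor (length a) i < a ! i"
  using assms by (auto simp: move_allowed_def)

lemma length_make_move [simp]: "length (make_move a i) = length a"
  by (simp add: make_move_def Let_def)

text \<open>The partial sums of \<open>a ! i - k\<close> work: their total over the whole cycle is
  0, so they also match across the wrap from the last position to 0.\<close>

lemma exists_height:
  assumes "sum_list a = k * length a"
  shows "\<exists>h. height k a h"
proof
  define h where "h j = (\<Sum>i<j. int (a ! i) - int k)" for j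
  have "int (sum_list a) = (\<Sum>i<length a. int (a ! i))"
    by (simp add: sum_list_sum_nth atLeast0LessThan)
  then have "h (length a) = 0"
    using assms by (simp add: h_def sum_subtractf mult.commute)
  moreover have "h (Suc i) = h i + int (a ! i) - int k" for i
    by (simp add: h_def)
  moreover have "h 0 = 0"
    by (simp add: h_def)
  ultimately show "height k a h"
    unfolding height_def by (metis neighbor_eq)
qed

lemma move_not_to_minimum:
  assumes h: "height k a h" and min: "\<And>j. j < length a \<Longrightarrow> h m \<le> h j"
    and move: "move_allowed a i"
  shows "h m < h (neighbor (length a) i)"
proof (rule ccontr)
  let ?j = "neighbor (length a) i"
  assume "\<not> h m < h ?j"
  moreover have i: "i < length a" and j: "?j < length a"
    using move_allowed_neighbor(1)[OF move] neighbor_less by auto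
  moreover have "h ?j = h i + int (a ! i) - int k"
    using h i by (simp add: height_def)
  moreover have "h (neighbor (length a) ?j) = h ?j + int (a ! ?j) - int k"
    using h j by (simp add: height_def)
  moreover have "h m \<le> h i" "h m \<le> h (neighbor (length a) ?j)"
    using min i neighbor_less[OF j] by auto
  \<comment> \<open>Now \<open>?j\<close> is a minimum too, so \<open>h\<close> does not rise on
    entering \<open>?j\<close> and does not fall on leaving it: \<open>a ! i\<close> \<le>
    \<open>k\<close> \<le> \<open>a ! ?j\<close>.\<close>
  ultimately have "a ! i \<le> a ! ?j"
    by linarith
  then show False
    using move_allowed_neighbor(3)[OF move] by simp
qed

text \<open>Lowering \<open>h\<close> at \<open>j\<close> alone decreases the increment from
  \<open>i\<close> to \<open>j\<close> by one and increases the increment out of \<open>j\<close> by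
  one, just as the move changes the two card counts.\<close>

lemma height_make_move:
  assumes h: "height k a h" and move: "move_allowed a i"
  defines "j \<equiv> neighbor (length a) i"
  shows "height k (make_move a i) (h(j := h j - 1))"
  unfolding height_def length_make_move
proof (intro allI impI)
  fix l assume l: "l < length a"
  note i = move_allowed_neighbor[OF move, folded j_def]
  have j: "j < length a"
    using neighbor_less[OF i(1)] by (simp add: j_def)
  have hl: "h (neighbor (length a) l) = h l + int (a ! l) - int k"
    using h l by (simp add: height_def)
  have nbr: "neighbor (length a) l = j \<longleftrightarrow> l = i"
    using neighbor_inject[OF l i(1)] by (simp add: j_def)
  have nth: "make_move a i ! l = (if l = j then a ! j + 1 else if l = i then a ! i - 1 else a ! l)"
    using l i j by (auto simp: make_move_def Let_def nth_list_update simp flip: j_def)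
  show "(h(j := h j - 1)) (neighbor (length a) l)
      = (h(j := h j - 1)) l + int (make_move a i ! l) - int k"
    using i hl nbr by (auto simp: nth)
qed

lemma move_sequence_avoids_minimum:
  assumes "height k a h" "\<And>j. j < length a \<Longrightarrow> h (neighbor (length a) i) \<le> h j"
    and "move_sequence a ms"
  shows "i \<notin> set ms"
  using assms
proof (induction ms arbitrary: a h)
  case Nil
  then show ?case by simp
next
  case (Cons l ms)
  let ?m = "neighbor (length a) i" and ?j = "neighbor (length a) l"
  have move: "move_allowed a l" and rest: "move_sequence (make_move a l) ms"
    using Cons.prems(3) by auto
  have less: "h ?m < h ?j"
    using move_not_to_minimum[OF Cons.prems(1) _ move] Cons.prems(2) by blast
  have "i \<notin> set ms"
  proof (rule Cons.IH[OF height_make_move[OF Cons.prems(1) move] _ rest])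
    \<comment> \<open>Heights are integers, so the strict inequality \<open>less\<close> survives as
      \<le> when \<open>h ?j\<close> drops by one.\<close>
    show "(h(?j := h ?j - 1)) (neighbor (length (make_move a l)) i) \<le> (h(?j := h ?j - 1)) j"
      if "j < length (make_move a l)" for j
      using less Cons.prems(2)[of j] that by auto
  qed
  \<comment> \<open>The first move is not at \<open>i\<close> either: \<open>l = i\<close> would
    turn \<open>less\<close> into \<open>h ?m < h ?m\<close>.\<close>
  then show ?case
    using less by auto
qed

theorem theorem5:
  fixes p k :: nat and a :: "nat list"
  assumes "p \<ge> 1"
    and "configuration p (k * p) a"
  shows "\<exists>i<p. \<forall>ms. move_sequence a ms \<longrightarrow> i \<notin> set ms"
proof -
  have len: "length a = p" and "sum_list a = k * length a"
    using assms(2) by (auto simp: configuration_def)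
  then obtain h where h: "height k a h"
    using exists_height by blast
  define m where "m = arg_min_on h {..<p}"
  have ne: "{..<p} \<noteq> {}"
    using assms(1) by (simp add: lessThan_empty_iff)
  have "m < p"
    using arg_min_if_finite(1)[OF _ ne, of h] by (simp add: m_def)
  \<comment> \<open>The player sought is the left neighbor of the minimum, the only one who could
    give a card to it.\<close>
  then obtain i where i: "i < p" "neighbor p i = m"
    by (rule neighbor_surj)
  have "h m \<le> h j" if "j < p" for j
    using arg_min_least[OF _ ne, of j h] that by (simp add: m_def)
  then have "i \<notin> set ms" if "move_sequence a ms" for ms
    using move_sequence_avoids_minimum[OF h _ that] i len by simp
  then show ?thesis
    using i by blast
qed

end
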